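(* Let $f(t)\in\mathbb{Z}[t]$ be a polynomial which does not vanish at roots of unity. Let $\ell_1,\dots,\ell_r$ be distinct prime numbers, and let $\mathcal{S}\subseteq\mathbb{N}$ be the set of those integers whose prime divisors are contained in $\{\ell_1,\dots,\ell_r\}$. Then: (1) for every $j\in\{1,\dots,r\}$ there exist a non-negative integer $\lambda_j(f)$ and an integer $\nu_j(f)$ such that for every $n=\ell_1^{k_1}\cdots\ell_j^{k_j}\cdots\ell_r^{k_r}\in\mathcal{S}$ we have that $$\mathrm{ord}_{\ell_j}(\Delta_n(f))=\mu_{\ell_j}(f)\cdot n+\lambda_j(f)\cdot k_j+\nu_j(f)$$ as long as $n$ is big enough, where $\mu_{\ell_j}(f)=-m_{\ell_j}(f)/\log(\ell_j)$; (2) for every prime $p\notin\{\ell_1,\dots,\ell_r\}$ there exists an integer $\nu(f)$ such that $$\mathrm{ord}_p(\Delta_n(f))=\mu_p(f)\cdot n+\nu(f)$$ for every $n\in\mathcal{S}$ which is big enough, where $\mu_p(f)=-m_p(f)/\log(p)$.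
   Context: $\mathbb{N}=\{1,2,\dots\}$. For a prime $q$, $\mathrm{ord}_q$ and $|\cdot|_q$ are the valuation and absolute value on $\mathbb{C}_q$ (a completion of an algebraic closure of $\mathbb{Q}_q$) with $\mathrm{ord}_q(q)=1$ and $|x|_q=q^{-\mathrm{ord}_q(x)}$. For $f(t)=a_d\prod_{i=1}^d(t-\alpha_i)\in\mathbb{Z}[t]$ with $a_d\ne0$ and roots $\alpha_i$ in $\overline{\mathbb{Q}}$ (embedded in $\mathbb{C}_q$): $\Delta_n(f)=a_d^n\prod_{i=1}^d(\alpha_i^n-1)\in\mathbb{Z}$ is the Pierce-Lehmer sequence of $f$; $M_q(f)=|a_d|_q\prod_{i=1}^d\max\{1,|\alpha_i|_q\}$ is the $q$-adic Mahler measure of $f$; $m_q(f)=\log M_q(f)$ is the logarithmic $q$-adic Mahler measure.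
   Formalization: "n big enough" is read as: n in S is a multiple of some fixed N in S, i.e. all exponents k_1,...,k_r are big enough; with the usual order the claim fails for r ≥ 2 (f = t-2, primes 7 and 3). *)

theory Defs
  imports "HOL-Analysis.Analysis" "HOL-Computational_Algebra.Computational_Algebra"
begin

section \<open>The field of \<open>q\<close>-adic complex numbers\<close>

text \<open>
  The libraries contain neither the field of \<open>q\<close>-adic numbers nor its completed algebraic
  closure. The latter is therefore described, on a field type \<open>'c\<close>, by an absolute value \<open>v\<close>
  for which \<open>'c\<close> is a completion of an algebraic closure of a completion of the rationals.
  Such a pair is unique up to isometric isomorphism, and one exists on the type \<open>complex\<close>
  for every prime \<open>q\<close>, by transport along an abstract field isomorphism.
\<close>

definition subfield_set :: "'c::field set \<Rightarrow> bool" where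
  "subfield_set F \<longleftrightarrow> 1 \<in> F \<and> (\<forall>x\<in>F. \<forall>y\<in>F. x - y \<in> F \<and> x * y \<in> F \<and> inverse x \<in> F)"

definition nonarch_absolute_value :: "('c::field \<Rightarrow> real) \<Rightarrow> bool" where
  "nonarch_absolute_value v \<longleftrightarrow>
     (\<forall>x. 0 \<le> v x) \<and> (\<forall>x. v x = 0 \<longleftrightarrow> x = 0) \<and>
     (\<forall>x y. v (x * y) = v x * v y) \<and> (\<forall>x y. v (x + y) \<le> max (v x) (v y))"

text \<open>
  On nonzero integers; by multiplicativity this determines \<open>v\<close> on the rationals, and in
  particular \<open>v q = 1 / q\<close>.
\<close>

definition extends_adic_abs :: "nat \<Rightarrow> ('c::field_char_0 \<Rightarrow> real) \<Rightarrow> bool" where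
  "extends_adic_abs q v \<longleftrightarrow>
     (\<forall>z::int. z \<noteq> 0 \<longrightarrow> v (of_int z) = real q powr (- real (multiplicity (int q) z)))"

definition is_completion_of :: "('c::field \<Rightarrow> real) \<Rightarrow> 'c set \<Rightarrow> 'c set \<Rightarrow> bool" where
  "is_completion_of v B A \<longleftrightarrow>
     subfield_set B \<and> A \<subseteq> B \<and>
     Metric_space.mcomplete B (\<lambda>x y. v (x - y)) \<and>
     Metric_space.mtopology B (\<lambda>x y. v (x - y)) closure_of A = B"

definition is_algebraic_closure_of :: "'c::field set \<Rightarrow> 'c set \<Rightarrow> bool" where
  "is_algebraic_closure_of A F \<longleftrightarrow>
     subfield_set A \<and> F \<subseteq> A \<and>
     (\<forall>x\<in>A. \<exists>p. p \<noteq> 0 \<and> (\<forall>i. coeff p i \<in> F) \<and> poly p x = 0) \<and>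
     (\<forall>p. (\<forall>i. coeff p i \<in> A) \<and> 0 < degree p \<longrightarrow> (\<exists>x\<in>A. poly p x = 0))"

definition adic_complex_abs :: "nat \<Rightarrow> ('c::field_char_0 \<Rightarrow> real) \<Rightarrow> bool" where
  "adic_complex_abs q v \<longleftrightarrow>
     nonarch_absolute_value v \<and> extends_adic_abs q v \<and>
     (\<exists>Q A. is_completion_of v Q \<rat> \<and> is_algebraic_closure_of A Q \<and>
            is_completion_of v UNIV A)"


section \<open>Mahler measures\<close>

text \<open>\<^const>\<open>proots\<close> is the multiset of roots, with multiplicities.\<close>

definition adic_mahler_measure :: "('c::field_char_0 \<Rightarrow> real) \<Rightarrow> int poly \<Rightarrow> real" where
  "adic_mahler_measure v f =
     v (of_int (lead_coeff f)) *
     (\<Prod>\<alpha>\<in>#proots (map_poly of_int f :: 'c poly). max 1 (v \<alpha>))"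

definition log_adic_mahler_measure :: "('c::field_char_0 \<Rightarrow> real) \<Rightarrow> int poly \<Rightarrow> real" where
  "log_adic_mahler_measure v f = ln (adic_mahler_measure v f)"

definition mu_invariant :: "nat \<Rightarrow> ('c::field_char_0 \<Rightarrow> real) \<Rightarrow> int poly \<Rightarrow> real" where
  "mu_invariant q v f = - log_adic_mahler_measure v f / ln (real q)"


section \<open>Pierce--Lehmer sequences\<close>

text \<open>
  The product over the roots is a symmetric expression with rational integer value, which is
  the integer selected here; the roots are taken in the complex numbers.
\<close>

definition pierce_lehmer :: "int poly \<Rightarrow> nat \<Rightarrow> int" where
  "pierce_lehmer f n =
     (THE z. of_int z =
        (of_int (lead_coeff f) :: complex) ^ n *
        (\<Prod>\<alpha>\<in>#proots (map_poly of_int f :: complex poly). \<alpha> ^ n - 1))"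

definition no_root_of_unity_root :: "int poly \<Rightarrow> bool" where
  "no_root_of_unity_root f \<longleftrightarrow>
     (\<forall>(z::complex) n. 0 < n \<and> z ^ n = 1 \<longrightarrow> poly (map_poly of_int f) z \<noteq> 0)"

definition smooth_numbers :: "nat set \<Rightarrow> nat set" where
  "smooth_numbers L = {n. 0 < n \<and> prime_factors n \<subseteq> L}"

text \<open>
  ``Big enough'' is meant with respect to divisibility: a property holds for all big enough
  \<open>n\<close> in \<open>S\<close> if it holds for all multiples \<open>n\<close> in \<open>S\<close> of some \<open>N\<close> in \<open>S\<close>. For the numbers
  \<open>n = l\<^sub>1 ^ k\<^sub>1 * \<dots> * l\<^sub>r ^ k\<^sub>r\<close> this says that all the exponents are big enough; for
  \<open>r = 1\<close> it is the same as \<open>n \<ge> N\<close> for some \<open>N\<close>. For \<open>r > 1\<close> the usual order of the naturals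
  will not do: with \<open>f = t - 2\<close> and the primes \<open>7\<close> and \<open>3\<close>, the \<open>7\<close>-adic valuation of
  \<open>2 ^ n - 1\<close> at \<open>n = 7 ^ a * 3 ^ b\<close> is \<open>0\<close> for \<open>b = 0\<close> and \<open>a + 1\<close> for \<open>b > 0\<close>.
\<close>

definition for_big_enough :: "nat set \<Rightarrow> (nat \<Rightarrow> bool) \<Rightarrow> bool" where
  "for_big_enough S P \<longleftrightarrow> (\<exists>N\<in>S. \<forall>n\<in>S. N dvd n \<longrightarrow> P n)"

end

theory Submission
  imports Defs "Jordan_Normal_Form.Determinant"
begin

text \<open>
  Up to sign, \<open>\<Delta>\<^sub>n(f)\<close> is the determinant of multiplication by \<open>f\<close> on \<open>\<int>[X]/(X\<^sup>n - 1)\<close>,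
  which is multiplicative in \<open>f\<close>; hence the product over the roots gives the same integer in every
  field over which \<open>f\<close> splits, and \<open>\<Delta>\<^sub>n(f)\<close> can be studied root by root in \<open>\<complex>\<^sub>q\<close>. If
  \<open>|x| > 1\<close> then \<open>|x\<^sup>n - 1| = |x|\<^sup>n\<close>, and if \<open>|x| < 1\<close> then \<open>|x\<^sup>n - 1| = 1\<close>. If \<open>|x| = 1\<close>, either
  \<open>|x\<^sup>n - 1| = 1\<close> for all \<open>n \<in> S\<close>, or some \<open>x\<^sup>N\<close> with \<open>N \<in> S\<close> lies in the open unit disc around \<open>1\<close>.
  In the last case, after replacing \<open>N\<close> by \<open>N q\<^sup>s\<close> if \<open>q\<close> is one of the given primes, lifting the
  exponent gives \<open>|x\<^sup>n - 1| = |x\<^sup>N - 1| |n / N|\<close> for all multiples \<open>n \<in> S\<close> of \<open>N\<close>. So \<open>\<lambda>\<close> counts the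
  roots of this last kind. The constant \<open>\<nu>\<close> is an integer because \<open>\<mu>\<close> is one: by Gauss's lemma the
  Mahler measure is the largest absolute value of a coefficient of \<open>f\<close>.
\<close>

section \<open>Circulant determinants\<close>

text \<open>For \<open>j < n\<close> this is the coefficient of \<open>X ^ j\<close> in the
  remainder of \<open>X ^ i * f\<close> modulo \<open>X ^ n - 1\<close>.\<close>

definition residue_sum :: "nat \<Rightarrow> 'a::comm_ring_1 poly \<Rightarrow> nat \<Rightarrow> nat \<Rightarrow> 'a" where
  "residue_sum n f i j = (\<Sum>k\<le>degree f. if (i + k) mod n = j then coeff f k else 0)"

text \<open>The matrix of multiplication by \<open>f\<close> modulo \<open>X ^ n - 1\<close>, in the basis of the powers of \<open>X\<close>.\<close>

definition circulant_mat :: "nat \<Rightarrow> 'a::comm_ring_1 poly \<Rightarrow> 'a mat" where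
  "circulant_mat n f = Matrix.mat n n (\<lambda>(i, j). residue_sum n f i j)"

text \<open>Padding with zero coefficients allows sums for polynomials of different degrees to share
  one range.\<close>

lemma residue_sum_bound:
  assumes "degree f \<le> m"
  shows "residue_sum n f i j = (\<Sum>k\<le>m. if (i + k) mod n = j then coeff f k else 0)"
  unfolding residue_sum_def using assms
  by (intro sum.mono_neutral_left ballI) (auto simp: coeff_eq_0)

lemma residue_sum_add:
  "residue_sum n (f + g) i j = residue_sum n f i j + residue_sum n g i j"
proof -
  let ?m = "max (degree f) (degree g)"
  have "residue_sum n (f + g) i j = (\<Sum>k\<le>?m. if (i + k) mod n = j then coeff (f + g) k else 0)"
    by (intro residue_sum_bound) (simp add: degree_add_le)
  also have "\<dots> = (\<Sum>k\<le>?m. if (i + k) mod n = j then coeff f k else 0) +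
      (\<Sum>k\<le>?m. if (i + k) mod n = j then coeff g k else 0)"
    by (subst sum.distrib[symmetric]) (intro sum.cong, auto)
  finally show ?thesis
    by (simp add: residue_sum_bound[of f ?m] residue_sum_bound[of g ?m])
qed

lemma residue_sum_smult: "residue_sum n (Polynomial.smult c f) i j = c * residue_sum n f i j"
  by (subst residue_sum_bound[of _ "degree f"])
     (auto simp: residue_sum_def sum_distrib_left degree_smult_le intro!: sum.cong)

text \<open>Multiplying \<open>f\<close> by \<open>X\<close> amounts to starting one row further
  down, cyclically, since only the residue of the exponent matters.\<close>

lemma residue_sum_pCons_0: "residue_sum n (pCons 0 f) i j = residue_sum n f (Suc i mod n) j"
proof -
  have "residue_sum n (pCons 0 f) i j =
      (\<Sum>k\<le>Suc (degree f). if (i + k) mod n = j then coeff (pCons 0 f) k else 0)"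
    by (intro residue_sum_bound) (simp add: degree_pCons_le)
  also have "\<dots> = (\<Sum>k\<le>degree f. if (i + Suc k) mod n = j then coeff f k else 0)"
    by (subst sum.atMost_Suc_shift) (simp cong: if_cong)
  also have "\<dots> = residue_sum n f (Suc i mod n) j"
    unfolding residue_sum_def by (simp add: mod_add_left_eq)
  finally show ?thesis .
qed

text \<open>Two separate summands are used because for \<open>n = 1\<close> both conditions hold at
  once and the contributions add up.\<close>

lemma residue_sum_linear:
  assumes "i < n"
  shows "residue_sum n [:- x, 1:] i j =
    (if i = j then - x else 0) + (if Suc i mod n = j then 1 else 0)"
  using assms by (simp add: residue_sum_def)

lemma circulant_mat_carrier [simp]: "circulant_mat n f \<in> carrier_mat n n"
  by (simp add: circulant_mat_def)

text \<open>Row \<open>i\<close> of the linear factor picks \<open>- x\<close> times row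
  \<open>i\<close> plus row \<open>Suc i mod n\<close> of the other matrix, which is the rule for
  multiplication by \<open>X - x\<close>. Applied root by root, this handles every split
  polynomial.\<close>

lemma circulant_mat_linear_mult:
  assumes "0 < n"
  shows "circulant_mat n ([:- x, 1:] * f) = circulant_mat n [:- x, 1:] * circulant_mat n f"
proof (rule eq_matI)
  fix i j
  assume "i < dim_row (circulant_mat n [:- x, 1:] * circulant_mat n f)"
    and "j < dim_col (circulant_mat n [:- x, 1:] * circulant_mat n f)"
  then have ij: "i < n" "j < n" by (simp_all add: circulant_mat_def)
  have "Matrix.index_mat (circulant_mat n [:- x, 1:] * circulant_mat n f) (i, j) =
      (\<Sum>k<n. residue_sum n [:- x, 1:] i k * residue_sum n f k j)"
    using ij by (simp add: circulant_mat_def scalar_prod_def lessThan_atLeast0)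
  also have "\<dots> = (\<Sum>k<n. if i = k then - x * residue_sum n f k j else 0) +
      (\<Sum>k<n. if Suc i mod n = k then residue_sum n f k j else 0)"
    by (subst sum.distrib[symmetric]) (intro sum.cong, auto simp: residue_sum_linear ij algebra_simps)
  also have "\<dots> = - x * residue_sum n f i j + residue_sum n f (Suc i mod n) j"
    using ij by (subst (1 2) sum.delta') auto
  also have "\<dots> = residue_sum n (Polynomial.smult (- x) f + pCons 0 f) i j"
    by (simp only: residue_sum_add residue_sum_smult residue_sum_pCons_0)
  also have "Polynomial.smult (- x) f + pCons 0 f = [:- x, 1:] * f"
    by simp
  finally show "Matrix.index_mat (circulant_mat n ([:- x, 1:] * f)) (i, j) =
      Matrix.index_mat (circulant_mat n [:- x, 1:] * circulant_mat n f) (i, j)"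
    using ij by (simp add: circulant_mat_def)
qed (simp_all add: circulant_mat_def)

text \<open>The matrix has \<open>- x\<close> on the diagonal and \<open>1\<close> on the cyclic
  superdiagonal, so expansion along column 0 leaves two triangular minors. For \<open>n = 1\<close>
  the two entries fall together.\<close>

lemma det_circulant_mat_linear:
  assumes "0 < n"
  shows "Determinant.det (circulant_mat n [:- x, 1:]) = (- 1) ^ n * (x ^ n - 1)"
proof (cases "n = 1")
  case True
  have "diag_mat (circulant_mat n [:- x, 1:]) = [1 - x]"
    using True by (simp add: diag_mat_def circulant_mat_def residue_sum_linear)
  then have "Determinant.det (circulant_mat n [:- x, 1:]) = 1 - x"
    using True by (subst det_upper_triangular[of _ n]) (auto simp: circulant_mat_def)
  then show ?thesis using True by simp
next
  case False
  \<comment> \<open>The minors have size \<open>Suc m\<close>, and the last row \<open>Suc m\<close>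
    is distinct from row 0.\<close>
  define m where "m = n - 2"
  have n: "n = Suc (Suc m)" using False assms by (simp add: m_def)
  let ?B = "circulant_mat n [:- x, 1:]"
  have B: "Matrix.index_mat ?B (i, j) = (if i = j then - x else 0) + (if Suc i mod n = j then 1 else 0)"
    if "i < n" "j < n" for i j
    using that by (simp add: circulant_mat_def residue_sum_linear)
  have dimB: "dim_row ?B = n" "dim_col ?B = n"
    by (simp_all add: circulant_mat_def)
  have carrier: "mat_delete ?B i 0 \<in> carrier_mat (Suc m) (Suc m)" for i
    using mat_delete_carrier[of ?B n n i 0] by (simp add: n)
  have upper: "Determinant.det (mat_delete ?B 0 0) = (- x) ^ Suc m"
  proof -
    have entry: "Matrix.index_mat (mat_delete ?B 0 0) (i, j) =
        (if i = j then - x else if Suc i = j then 1 else 0)" if "i < Suc m" "j < Suc m" for i j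
      using that by (auto simp: mat_delete_def circulant_mat_def residue_sum_linear n mod_Suc)
    have "diag_mat (mat_delete ?B 0 0) = replicate (Suc m) (- x)"
      by (intro nth_equalityI) (auto simp: diag_mat_def entry[unfolded n] dimB[unfolded n] n simp del: upt_Suc replicate_Suc)
    moreover have "upper_triangular (mat_delete ?B 0 0)"
      by (intro upper_triangularI) (auto simp: entry[unfolded n] dimB[unfolded n] n)
    ultimately show ?thesis
      using det_upper_triangular[OF _ carrier[of 0]] by (simp only: prod_list_replicate)
  qed
  have lower: "Determinant.det (mat_delete ?B (Suc m) 0) = 1"
  proof -
    have entry: "Matrix.index_mat (mat_delete ?B (Suc m) 0) (i, j) =
        (if i = j then 1 else if i = Suc j then - x else 0)" if "i < Suc m" "j < Suc m" for i j
      using that by (auto simp: mat_delete_def circulant_mat_def residue_sum_linear n mod_Suc)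
    have "diag_mat (mat_delete ?B (Suc m) 0) = replicate (Suc m) 1"
      by (intro nth_equalityI) (auto simp: diag_mat_def entry[unfolded n] dimB[unfolded n] n simp del: upt_Suc replicate_Suc)
    then show ?thesis
      using det_lower_triangular[OF _ carrier[of "Suc m"]] entry
      by (simp add: prod_list_replicate del: replicate_Suc)
  qed
  have "Determinant.det ?B =
      (\<Sum>i<n. Matrix.index_mat ?B (i, 0) * Determinant.cofactor ?B i 0)"
    using assms by (intro laplace_expansion_column) auto
  \<comment> \<open>Column 0 can be nonzero only in row 0, on the diagonal, and in the last row,
    where the superdiagonal wraps around.\<close>
  also have "\<dots> = (\<Sum>i\<in>{0, Suc m}. Matrix.index_mat ?B (i, 0) * Determinant.cofactor ?B i 0)"
    by (intro sum.mono_neutral_right) (auto simp: n B[unfolded n] mod_Suc)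
  also have "\<dots> = (- x) ^ n + (- 1) ^ Suc m"
    by (simp add: B[unfolded n] n Determinant.cofactor_def upper[unfolded n] lower[unfolded n])
  finally show ?thesis
    by (simp add: n power_minus[of x] algebra_simps)
qed

lemma det_circulant_mat_split:
  assumes "0 < n"
  shows "Determinant.det (circulant_mat n (Polynomial.smult a (\<Prod>x\<in>#R. [:- x, 1:]))) =
    (- 1) ^ (n * size R) * (a ^ n * (\<Prod>x\<in>#R. x ^ n - 1))"
proof (induction R)
  case empty
  have "circulant_mat n [:a:] = a \<cdot>\<^sub>m 1\<^sub>m n"
    by (intro eq_matI) (auto simp: circulant_mat_def residue_sum_def)
  then show ?case by simp
next
  case (add x R)
  let ?g = "Polynomial.smult a (\<Prod>x\<in>#R. [:- x, 1:])"
  have "Polynomial.smult a (\<Prod>x\<in>#add_mset x R. [:- x, 1:]) = [:- x, 1:] * ?g"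
    by (simp only: image_mset_add_mset prod_mset.add_mset mult_smult_right)
  then have "Determinant.det (circulant_mat n (Polynomial.smult a (\<Prod>x\<in>#add_mset x R. [:- x, 1:]))) =
      Determinant.det (circulant_mat n [:- x, 1:]) * Determinant.det (circulant_mat n ?g)"
    using assms by (simp only: circulant_mat_linear_mult det_mult[OF circulant_mat_carrier circulant_mat_carrier])
  then show ?case
    by (simp only: add.IH det_circulant_mat_linear[OF assms])
       (simp add: power_add algebra_simps)
qed

lemma circulant_mat_of_int:
  "circulant_mat n (map_poly of_int f :: 'a::{comm_ring_1,ring_char_0} poly) =
    map_mat of_int (circulant_mat n f)"
proof -
  have "residue_sum n (map_poly of_int f :: 'a poly) i j = of_int (residue_sum n f i j)" for i j
    by (subst residue_sum_bound[of _ "degree f"])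
       (auto simp: residue_sum_def degree_map_poly coeff_map_poly intro!: sum.cong)
  then show ?thesis by (intro eq_matI) (auto simp: circulant_mat_def)
qed

lemma degree_prod_mset_linear:
  "degree (\<Prod>x\<in>#R. [:- x, 1:] :: 'a::idom poly) = size R"
proof (induction R)
  case (add x R)
  have "(\<Prod>x\<in>#R. [:- x, 1:]) \<noteq> 0" by (auto simp: prod_mset_zero_iff)
  then show ?case using add by (simp add: degree_mult_eq del: mult_pCons_left)
qed simp

text \<open>The determinant is formed over the integers, so the left side depends only on
  \<open>f\<close> and \<open>n\<close> and not on the field containing the roots. The sign cancels
  the one in \<open>det_circulant_mat_split\<close>.\<close>

lemma of_int_det_circulant_mat:
  fixes f :: "int poly"
  assumes "0 < n" "f \<noteq> 0"
    and "map_poly of_int f = Polynomial.smult (of_int (lead_coeff f) :: 'a::field_char_0) (\<Prod>x\<in>#R. [:- x, 1:])"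
  shows "of_int ((- 1) ^ (n * degree f) * Determinant.det (circulant_mat n f)) =
    (of_int (lead_coeff f) :: 'a) ^ n * (\<Prod>x\<in>#R. x ^ n - 1)"
proof -
  have "degree (Polynomial.smult (of_int (lead_coeff f) :: 'a) (\<Prod>x\<in>#R. [:- x, 1:])) = size R"
    using assms(2) by (simp add: degree_prod_mset_linear)
  \<comment> \<open>Comparing degrees makes the sign independent of the field and of
    \<open>R\<close>.\<close>
  then have "size R = degree f"
    using assms(2) unfolding assms(3)[symmetric] by (subst (asm) degree_map_poly) auto
  moreover have "of_int (Determinant.det (circulant_mat n f)) =
      (- 1) ^ (n * size R) * ((of_int (lead_coeff f) :: 'a) ^ n * (\<Prod>x\<in>#R. x ^ n - 1))"
    unfolding det_circulant_mat_split[OF assms(1), symmetric] assms(3)[symmetric]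
      circulant_mat_of_int of_int_hom.hom_det ..
  ultimately have "of_int ((- 1) ^ (n * degree f) * Determinant.det (circulant_mat n f)) =
      ((- 1) ^ (n * degree f) * (- 1) ^ (n * degree f)) *
      ((of_int (lead_coeff f) :: 'a) ^ n * (\<Prod>x\<in>#R. x ^ n - 1))"
    by (simp only: of_int_mult of_int_power of_int_minus of_int_1 mult.assoc)
  also have "(- 1) ^ (n * degree f) * (- 1) ^ (n * degree f) = (1 :: 'a)"
    by (cases "even (n * degree f)") auto
  finally show ?thesis by (simp only: mult_1)
qed

lemma map_poly_of_int_split_imp_proots:
  fixes f :: "int poly" and R :: "'a::field_char_0 multiset"
  assumes "f \<noteq> 0" "(map_poly of_int f) = Polynomial.smult (of_int (lead_coeff f)) (\<Prod>x\<in>#R. [:- x, 1:])"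
  shows "proots (map_poly of_int f :: 'a poly) = R"
proof -
  have "proots (\<Prod>x\<in>#R. [:- x, 1:]) = R"
  proof (induction R)
    case (add x R)
    have "(\<Prod>x\<in>#R. [:- x, 1:]) \<noteq> 0" by (auto simp: prod_mset_zero_iff)
    then show ?case using add by (simp add: proots_mult del: mult_pCons_left)
  qed simp
  then show ?thesis
    unfolding assms(2) using assms(1) by (subst proots_smult) auto
qed

section \<open>Splitting over an algebraically closed subfield\<close>

lemma subfield_set_closed:
  assumes "subfield_set F"
  shows subfield_set_0: "0 \<in> F" and subfield_set_add: "\<And>x y. x \<in> F \<Longrightarrow> y \<in> F \<Longrightarrow> x + y \<in> F"
    and subfield_set_of_int: "of_int z \<in> F"
proof -
  have diff: "x - y \<in> F" if "x \<in> F" "y \<in> F" for x y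
    using assms that by (simp add: subfield_set_def)
  have 1: "1 \<in> F" using assms by (simp add: subfield_set_def)
  show 0: "0 \<in> F" using diff[OF 1 1] by simp
  show add: "x + y \<in> F" if "x \<in> F" "y \<in> F" for x y
    using diff[OF that(1) diff[OF 0 that(2)]] by simp
  show "of_int z \<in> F"
  proof (induction z)
    case (nonneg n)
    then show ?case by (induction n) (auto intro: 0 1 add)
  next
    case (neg n)
    have "of_nat k \<in> F" for k by (induction k) (auto intro: 0 1 add)
    from diff[OF 0 this[of "Suc n"]] show ?case by simp
  qed
qed

text \<open>The coefficients of the quotient are the Horner values at \<open>x\<close> of the tails
  of \<open>p\<close>.\<close>

lemma synthetic_div_coeff_closed:
  assumes "subfield_set F" "x \<in> F" "\<And>i. coeff p i \<in> F"
  shows "coeff (synthetic_div p x) i \<in> F"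
  using assms(3)
proof (induction p arbitrary: i)
  case 0
  then show ?case by simp
next
  case (pCons a p)
  have p: "coeff p i \<in> F" for i using pCons.prems[of "Suc i"] by simp
  have "poly p x \<in> F"
    using p
  proof (induction p)
    case (pCons b q)
    have "coeff q i \<in> F" for i using pCons.prems[of "Suc i"] by simp
    moreover have "b \<in> F" using pCons.prems[of 0] by simp
    ultimately show ?case using pCons.IH assms(1,2)
      by (auto intro!: subfield_set_add simp: subfield_set_def)
  qed (simp add: subfield_set_0[OF assms(1)])
  then show ?case using pCons.IH[OF p] by (auto simp: coeff_pCons split: nat.split)
qed

text \<open>Splitting off a root in \<open>A\<close> leaves a quotient with coefficients in
  \<open>A\<close>, so induction on the degree applies.\<close>

lemma is_algebraic_closure_of_split:
  assumes "is_algebraic_closure_of A F" "\<And>i. coeff p i \<in> A" "p \<noteq> 0"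
  shows "\<exists>R. p = Polynomial.smult (lead_coeff p) (\<Prod>x\<in>#R. [:- x, 1:])"
  using assms(2,3)
proof (induction "degree p" arbitrary: p)
  case 0
  then obtain c where "p = [:c:]" by (metis degree_eq_zeroE)
  then have "p = Polynomial.smult (lead_coeff p) (\<Prod>x\<in>#{#}. [:- x, 1:])" by simp
  then show ?case by (rule exI)
next
  case (Suc d)
  have "0 < degree p" using Suc.hyps(2) by simp
  then obtain x where x: "x \<in> A" "poly p x = 0"
    using assms(1) Suc.prems(1) unfolding is_algebraic_closure_of_def by metis
  define q where "q = synthetic_div p x"
  have p: "p = [:- x, 1:] * q"
    using synthetic_div_correct'[of x p] x by (simp add: q_def)
  then have q0: "q \<noteq> 0" using Suc.prems(2) by auto
  have "degree p = degree [:- x, 1:] + degree q"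
    unfolding p by (rule degree_mult_eq) (use q0 in auto)
  then have "d = degree q" using Suc.hyps(2) by simp
  moreover have "coeff q i \<in> A" for i
    unfolding q_def using assms(1) x Suc.prems(1)
    by (intro synthetic_div_coeff_closed) (auto simp: is_algebraic_closure_of_def)
  ultimately obtain R where R: "q = Polynomial.smult (lead_coeff q) (\<Prod>x\<in>#R. [:- x, 1:])"
    using Suc.hyps(1)[of q] q0 by metis
  have "lead_coeff p = lead_coeff q"
    unfolding p lead_coeff_mult by simp
  then have "p = Polynomial.smult (lead_coeff p) (\<Prod>x\<in>#add_mset x R. [:- x, 1:])"
    unfolding image_mset_add_mset prod_mset.add_mset mult_smult_right[symmetric]
    using p R by simp
  then show ?case by (rule exI)
qed

text \<open>The integer coefficients of \<open>f\<close> lie in the algebraically closed subfield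
  \<open>A\<close>, over which \<open>f\<close> already splits.\<close>

lemma adic_complex_abs_split:
  fixes v :: "'c::field_char_0 \<Rightarrow> real" and f :: "int poly"
  assumes "adic_complex_abs q v" "f \<noteq> 0"
  shows "map_poly of_int f =
    Polynomial.smult (of_int (lead_coeff f)) (\<Prod>x\<in>#proots (map_poly of_int f :: 'c poly). [:- x, 1:])"
proof -
  let ?g = "map_poly of_int f :: 'c poly"
  from assms(1) obtain Q A where A: "is_algebraic_closure_of A (Q :: 'c set)"
    unfolding adic_complex_abs_def by blast
  have lc: "lead_coeff ?g = of_int (lead_coeff f)"
    using assms(2) by (simp add: degree_map_poly coeff_map_poly)
  have "coeff ?g i \<in> A" for i
    using A by (simp add: coeff_map_poly is_algebraic_closure_of_def subfield_set_of_int)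
  moreover have "?g \<noteq> 0" using assms(2) lc by auto
  ultimately obtain R where R: "?g = Polynomial.smult (lead_coeff ?g) (\<Prod>x\<in>#R. [:- x, 1:])"
    by (rule exE[OF is_algebraic_closure_of_split[OF A]])
  then have "proots ?g = R"
    unfolding lc by (rule map_poly_of_int_split_imp_proots[OF assms(2)])
  with R show ?thesis by (simp only: lc)
qed

section \<open>Nonarchimedean absolute values\<close>

locale nonarchimedean_field =
  fixes v :: "'c::field_char_0 \<Rightarrow> real"
  assumes nonarch: "nonarch_absolute_value v"
begin

lemma nonneg [simp]: "0 \<le> v x"
  and eq_0_iff [simp]: "v x = 0 \<longleftrightarrow> x = 0"
  and mult: "v (x * y) = v x * v y"
  and add_le: "v (x + y) \<le> max (v x) (v y)"
  using nonarch by (auto simp: nonarch_absolute_value_def)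

lemma zero [simp]: "v 0 = 0"
  by simp

lemma pos_iff [simp]: "0 < v x \<longleftrightarrow> x \<noteq> 0"
  using nonneg[of x] eq_0_iff[of x] by linarith

lemma one [simp]: "v 1 = 1"
  using mult[of 1 1] by simp

lemma uminus [simp]: "v (- x) = v x"
proof -
  have "v (- 1) * v (- 1) = 1" by (simp flip: mult)
  then have "v (- 1) = 1"
    using nonneg[of "- 1"] by (metis abs_of_nonneg abs_square_eq_1 power2_eq_square)
  then show ?thesis using mult[of "- 1" x] by simp
qed

lemma power: "v (x ^ n) = v x ^ n"
  by (induction n) (simp_all add: mult)

lemma prod_mset: "v (\<Prod>x\<in>#R. g x) = (\<Prod>x\<in>#R. v (g x))"
  by (induction R) (simp_all add: mult)

lemma diff_le: "v (x - y) \<le> max (v x) (v y)"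
  using add_le[of x "- y"] by simp

text \<open>Writing \<open>y\<close> as \<open>(x + y) - x\<close> bounds \<open>v y\<close> by the
  larger of \<open>v (x + y)\<close> and \<open>v x\<close>, and the latter is too small.\<close>

lemma add_eq_right:
  assumes "v x < v y"
  shows "v (x + y) = v y"
  using add_le[of x y] diff_le[of "x + y" x] assms by simp

lemma of_nat_le_1: "v (of_nat n) \<le> 1"
proof (induction n)
  case (Suc n)
  then show ?case using add_le[of 1 "of_nat n"] by simp
qed simp

section \<open>Powers of elements close to 1\<close>

lemma power_minus_1_le:
  assumes "v (y - 1) \<le> 1"
  shows "v (y ^ n - 1) \<le> v (y - 1)"
proof (induction n)
  case (Suc n)
  have "v y \<le> 1" using add_le[of "y - 1" 1] assms by simp
  then have "v (y * (y ^ n - 1)) \<le> v (y - 1)"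
    using Suc mult_mono[of "v y" 1 "v (y ^ n - 1)" "v (y - 1)"] by (simp add: mult)
  moreover have "y ^ Suc n - 1 = y * (y ^ n - 1) + (y - 1)"
    by (simp add: algebra_simps)
  then have "v (y ^ Suc n - 1) \<le> max (v (y * (y ^ n - 1))) (v (y - 1))"
    by (simp only: add_le)
  ultimately show ?case by simp
qed simp

text \<open>Each of the \<open>n\<close> powers is congruent to 1 modulo
  \<open>y - 1\<close>.\<close>

lemma geometric_sum_minus_le:
  assumes "v (y - 1) \<le> 1"
  shows "v ((\<Sum>i<n. y ^ i) - of_nat n) \<le> v (y - 1)"
proof (induction n)
  case (Suc n)
  have "(\<Sum>i<Suc n. y ^ i) - of_nat (Suc n) = ((\<Sum>i<n. y ^ i) - of_nat n) + (y ^ n - 1)"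
    by simp
  then have "v ((\<Sum>i<Suc n. y ^ i) - of_nat (Suc n)) \<le>
      max (v ((\<Sum>i<n. y ^ i) - of_nat n)) (v (y ^ n - 1))"
    by (metis add_le)
  then show ?case using Suc power_minus_1_le[OF assms, of n] by simp
qed simp

text \<open>In \<open>y ^ m - 1 = (y - 1) * (\<Sum>i<m. y ^ i)\<close> the sum differs from
  \<open>m\<close> by less than \<open>v (of_nat m)\<close>, so it has the same absolute value as
  \<open>m\<close>.\<close>

lemma power_minus_1_eq:
  assumes "v (y - 1) < v (of_nat m)"
  shows "v (y ^ m - 1) = v (y - 1) * v (of_nat m)"
proof -
  have le: "v (y - 1) \<le> 1" using assms of_nat_le_1[of m] by simp
  have "v (((\<Sum>i<m. y ^ i) - of_nat m) + of_nat m) = v (of_nat m)"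
    using geometric_sum_minus_le[OF le, of m] assms by (intro add_eq_right) simp
  then show ?thesis by (simp add: power_diff_1_eq mult)
qed

text \<open>One prime \<open>p\<close> is peeled off \<open>m\<close> at a time. Since
  \<open>y ^ p\<close> is no further from 1 than \<open>y\<close>, the hypotheses persist, and
  closeness is required only relative to single primes, not to \<open>m\<close>.\<close>

lemma lifting_the_exponent:
  assumes "v (y - 1) < 1" "0 < m" "\<And>p. prime p \<Longrightarrow> p dvd m \<Longrightarrow> v (y - 1) < v (of_nat p)"
  shows "v (y ^ m - 1) = v (y - 1) * v (of_nat m)"
  using assms
proof (induction m arbitrary: y rule: less_induct)
  case (less m)
  show ?case
  proof (cases "m = 1")
    case False
    then obtain p k where p: "prime p" "m = p * k"
      using prime_factor_nat[of m] by (auto elim: dvdE)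
    have yp: "v (y ^ p - 1) = v (y - 1) * v (of_nat p)"
      using less.prems(3)[of p] p by (intro power_minus_1_eq) simp
    then have le: "v (y ^ p - 1) \<le> v (y - 1)"
      using of_nat_le_1[of p] by (simp add: mult_left_le)
    have "k < m" using p less.prems(2) prime_gt_1_nat[OF p(1)] by auto
    moreover have "v (y ^ p - 1) < v (of_nat p')" if "prime p'" "p' dvd k" for p'
      using le less.prems(3)[of p'] that p(2) by force
    ultimately have "v ((y ^ p) ^ k - 1) = v (y ^ p - 1) * v (of_nat k)"
      using le less.prems(1,2) p(2) by (intro less.IH) auto
    then show ?thesis using yp p(2) by (simp add: power_mult mult)
  qed simp
qed

text \<open>Raising \<open>z\<close> to the power \<open>q\<close> multiplies \<open>z - 1\<close>
  by a geometric sum congruent to \<open>q\<close> modulo \<open>z - 1\<close>. Each step thus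
  shrinks the distance to 1 by a factor of at most \<open>c < 1\<close>.\<close>

lemma power_prime_power_minus_1_small:
  assumes "v (y - 1) < 1" "v (of_nat q) < 1" "0 < e"
  shows "\<exists>s. v (y ^ (q ^ s) - 1) < e"
proof -
  define c where "c = max (v (y - 1)) (v (of_nat q))"
  have c: "0 \<le> c" "c < 1" using assms by (auto simp: c_def le_max_iff_disj)
  have bound: "v (y ^ (q ^ s) - 1) \<le> c ^ s" for s
  proof (induction s)
    case 0
    then show ?case using assms(1) by simp
  next
    case (Suc s)
    let ?z = "y ^ (q ^ s)"
    have z: "v (?z - 1) \<le> v (y - 1)" using assms(1) by (intro power_minus_1_le) simp
    have "v ((\<Sum>i<q. ?z ^ i) - of_nat q) \<le> v (?z - 1)"
      using z assms(1) by (intro geometric_sum_minus_le) simp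
    then have "v (\<Sum>i<q. ?z ^ i) \<le> c"
      using add_le[of "(\<Sum>i<q. ?z ^ i) - of_nat q" "of_nat q"] z by (auto simp: c_def)
    then have "v (?z ^ q - 1) \<le> c ^ s * c"
      unfolding power_diff_1_eq[of ?z] mult using Suc c by (intro mult_mono) auto
    then show ?case by (simp only: power_mult[symmetric] power_Suc mult.commute)
  qed
  obtain s where "c ^ s < e" using real_arch_pow_inv[OF assms(3) c(2)] by blast
  with bound[of s] show ?thesis by (meson order.strict_trans1)
qed

text \<open>By induction on the roots: the ultrametric inequality gives the upper bound for the
  coefficients, and an index attaining it is found by isolating one dominant term.\<close>

lemma gauss_lemma:
  "\<exists>i. v (coeff (Polynomial.smult a (\<Prod>x\<in>#R. [:- x, 1:])) i) = v a * (\<Prod>x\<in>#R. max 1 (v x)) \<and>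
    (\<forall>j. v (coeff (Polynomial.smult a (\<Prod>x\<in>#R. [:- x, 1:])) j) \<le> v a * (\<Prod>x\<in>#R. max 1 (v x)))"
proof (induction R)
  case empty
  show ?case by (rule exI[of _ 0]) (auto simp: coeff_pCons mult split: nat.split)
next
  case (add x R)
  define g where "g = Polynomial.smult a (\<Prod>x\<in>#R. [:- x, 1:])"
  define m where "m = v a * (\<Prod>x\<in>#R. max 1 (v x))"
  define h where "h = Polynomial.smult a (\<Prod>x\<in>#add_mset x R. [:- x, 1:])"
  have le: "v (coeff g j) \<le> m" for j using add by (simp add: g_def m_def)
  obtain i0 where i0: "v (coeff g i0) = m" using add by (auto simp: g_def m_def)
  have m0: "0 \<le> m" using i0 nonneg by metis
  have h: "h = [:- x, 1:] * g"
    unfolding h_def g_def by (simp only: image_mset_add_mset prod_mset.add_mset mult_smult_right)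
  have coeff_h: "coeff h j = (case j of 0 \<Rightarrow> 0 | Suc k \<Rightarrow> coeff g k) - x * coeff g j" for j
    by (simp add: h coeff_pCons split: nat.split)
  have bound: "v (coeff h j) \<le> max 1 (v x) * m" for j
  proof -
    have "v (x * coeff g j) \<le> max 1 (v x) * m"
      unfolding mult using le m0 by (intro mult_mono) auto
    moreover have "m \<le> max 1 (v x) * m" using m0 by (simp add: mult_le_cancel_right1)
    then have "v (case j of 0 \<Rightarrow> 0 | Suc k \<Rightarrow> coeff g k) \<le> max 1 (v x) * m"
      using le m0 by (cases j) (auto intro: order.trans)
    ultimately show ?thesis
      unfolding coeff_h using diff_le by (meson max.boundedI order.trans)
  qed
  have "\<exists>i. v (coeff h i) = max 1 (v x) * m"
  proof (cases "m = 0")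
    case True
    then show ?thesis using bound[of 0] nonneg[of "coeff h 0"] by (intro exI[of _ 0]) simp
  next
    case False
    with m0 have m: "0 < m" by simp
    show ?thesis
    proof (cases "1 < v x")
      case True
      \<comment> \<open>At an index where \<open>g\<close> attains its maximum, the term multiplied
        by \<open>x\<close> strictly dominates the shifted one.\<close>
      have "v (case i0 of 0 \<Rightarrow> 0 | Suc k \<Rightarrow> coeff g k) < v (- (x * coeff g i0))"
      proof -
        have "v (case i0 of 0 \<Rightarrow> 0 | Suc k \<Rightarrow> coeff g k) \<le> m"
          using le m by (cases i0) auto
        also have "m < v x * m" using True m by simp
        finally show ?thesis by (simp add: mult i0)
      qed
      from add_eq_right[OF this] have "v (coeff h i0) = v x * m"
        by (simp add: coeff_h mult i0)
      then show ?thesis using True by auto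
    next
      case False
      \<comment> \<open>For \<open>v x \<le> 1\<close> the last maximal index is taken: the
        coefficient of \<open>g\<close> after it is strictly smaller, so the shifted term dominates
        in \<open>coeff h (Suc i)\<close>. Positivity of \<open>m\<close> keeps the index set
        finite.\<close>
      define i where "i = Max {i. v (coeff g i) = m}"
      have "{i. v (coeff g i) = m} \<subseteq> {..degree g}"
        using m by (auto intro!: le_degree)
      then have fin: "finite {i. v (coeff g i) = m}" using finite_subset by blast
      have i: "v (coeff g i) = m" using Max_in[OF fin] i0 by (auto simp: i_def)
      have "v (coeff g (Suc i)) \<noteq> m" using Max_ge[OF fin, of "Suc i"] by (auto simp: i_def)
      with le[of "Suc i"] have "v (coeff g (Suc i)) < m" by simp
      moreover have "v (x * coeff g (Suc i)) \<le> v (coeff g (Suc i))"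
        using False by (simp add: mult mult_left_le_one_le)
      ultimately have "v (- (x * coeff g (Suc i)) + coeff g i) = m"
        by (subst add_eq_right) (use i in auto)
      then have "v (coeff h (Suc i)) = m" by (simp add: coeff_h)
      then show ?thesis using False by (intro exI[of _ "Suc i"]) simp
    qed
  qed
  with bound show ?case
    by (simp add: h_def[symmetric] m_def algebra_simps del: prod_mset.insert image_mset_add_mset)
       (simp add: algebra_simps)
qed

end

section \<open>Pierce--Lehmer sequences along smooth numbers\<close>

lemma smooth_numbers_one [simp]: "Suc 0 \<in> smooth_numbers L"
  by (simp add: smooth_numbers_def)

lemma smooth_numbers_pos: "n \<in> smooth_numbers L \<Longrightarrow> 0 < n"
  by (simp add: smooth_numbers_def)

lemma smooth_numbers_prime_dvd:
  "n \<in> smooth_numbers L \<Longrightarrow> prime p \<Longrightarrow> p dvd n \<Longrightarrow> p \<in> L"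
  by (auto simp: smooth_numbers_def prime_factors_dvd)

lemma smooth_numbers_mult:
  "m \<in> smooth_numbers L \<Longrightarrow> n \<in> smooth_numbers L \<Longrightarrow> m * n \<in> smooth_numbers L"
  by (auto simp: smooth_numbers_def prime_factors_product)

lemma smooth_numbers_prime_power:
  assumes "prime q" "q \<in> L"
  shows "q ^ s \<in> smooth_numbers L"
proof (induction s)
  case (Suc s)
  have "q \<in> smooth_numbers L"
    using assms by (simp add: smooth_numbers_def prime_prime_factors prime_gt_0_nat)
  from smooth_numbers_mult[OF this Suc] show ?case by simp
qed (simp add: smooth_numbers_def)

lemma for_big_enough_mono:
  "for_big_enough S P \<Longrightarrow> (\<And>n. n \<in> S \<Longrightarrow> P n \<Longrightarrow> Q n) \<Longrightarrow> for_big_enough S Q"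
  unfolding for_big_enough_def by blast

text \<open>The signed determinant \<open>D\<close> is an integer equal to the root product both
  over the complex numbers, which identifies it with \<open>pierce_lehmer f n\<close>, and over the
  field \<open>'a\<close>.\<close>

lemma of_int_pierce_lehmer:
  fixes f :: "int poly"
  assumes "f \<noteq> 0" "0 < n"
    and split: "map_poly of_int f =
      Polynomial.smult (of_int (lead_coeff f) :: 'a::field_char_0) (\<Prod>x\<in>#R. [:- x, 1:])"
  shows "of_int (pierce_lehmer f n) = (of_int (lead_coeff f) :: 'a) ^ n * (\<Prod>x\<in>#R. x ^ n - 1)"
proof -
  define D where "D = (- 1) ^ (n * degree f) * Determinant.det (circulant_mat n f)"
  let ?g = "map_poly of_int f :: complex poly"
  have "degree ?g = degree f" by (rule degree_map_poly) simp
  then have lc: "lead_coeff ?g = of_int (lead_coeff f)" by (simp add: coeff_map_poly)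
  have "?g \<noteq> 0" using assms(1) lc by auto
  then obtain T where "?g = Polynomial.smult (lead_coeff ?g) (\<Prod>x\<in>#T. [:- x, 1:])"
    by (elim exE[OF alg_closed_imp_factorization] conjE)
  then have T: "?g = Polynomial.smult (of_int (lead_coeff f)) (\<Prod>x\<in>#T. [:- x, 1:])"
    by (simp only: lc)
  have "of_int D = (of_int (lead_coeff f) :: complex) ^ n * (\<Prod>x\<in>#proots ?g. x ^ n - 1)"
    unfolding D_def map_poly_of_int_split_imp_proots[OF assms(1) T]
    by (rule of_int_det_circulant_mat[OF assms(2,1) T])
  then have "pierce_lehmer f n = D"
    unfolding pierce_lehmer_def by (intro the_equality) (simp_all only: of_int_eq_iff[where 'a = complex, symmetric])
  then show ?thesis
    using of_int_det_circulant_mat[OF assms(2,1) split] by (simp only: D_def)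
qed

lemma no_root_of_unity_root_neq_0: "no_root_of_unity_root f \<Longrightarrow> f \<noteq> 0"
  unfolding no_root_of_unity_root_def
  by (drule spec[of _ 1], drule spec[of _ 1]) auto

text \<open>Over the complex numbers a vanishing product would force a root of \<open>f\<close> with
  \<open>x ^ n = 1\<close>.\<close>

lemma pierce_lehmer_neq_0:
  assumes "no_root_of_unity_root f" "0 < n"
  shows "pierce_lehmer f n \<noteq> 0"
proof
  assume 0: "pierce_lehmer f n = 0"
  let ?g = "map_poly of_int f :: complex poly"
  note f0 = no_root_of_unity_root_neq_0[OF assms(1)]
  have "degree ?g = degree f" by (rule degree_map_poly) simp
  then have lc: "lead_coeff ?g = of_int (lead_coeff f)" by (simp add: coeff_map_poly)
  have g0: "?g \<noteq> 0" using f0 lc by auto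
  then obtain T where "?g = Polynomial.smult (lead_coeff ?g) (\<Prod>x\<in>#T. [:- x, 1:])"
    by (elim exE[OF alg_closed_imp_factorization] conjE)
  then have T: "?g = Polynomial.smult (of_int (lead_coeff f)) (\<Prod>x\<in>#T. [:- x, 1:])"
    by (simp only: lc)
  from of_int_pierce_lehmer[OF f0 assms(2) T] 0 f0 obtain x where x: "x \<in># T" "x ^ n = 1"
    by (auto simp: prod_mset_zero_iff)
  have "x \<in># proots ?g" using x map_poly_of_int_split_imp_proots[OF f0 T] by (simp only:)
  then have "poly ?g x = 0" using g0 by simp
  with x assms show False by (auto simp: no_root_of_unity_root_def)
qed

section \<open>Absolute values of \<open>x ^ n - 1\<close> along smooth numbers\<close>

context nonarchimedean_field
begin

text \<open>All cases are cast in one shape that is stable under products over the roots. The first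
  three take \<open>N = 1\<close>, \<open>C = 1\<close> and \<open>lam = 0\<close>; only the last
  one has \<open>lam = 1\<close>.\<close>

lemma power_minus_1_eventually:
  assumes q: "prime q" "v (of_nat q) < 1"
    and unit: "\<And>p. prime p \<Longrightarrow> p \<noteq> q \<Longrightarrow> v (of_nat p) = 1"
    and x: "\<And>n. 0 < n \<Longrightarrow> x ^ n \<noteq> 1"
  shows "\<exists>N\<in>smooth_numbers L. \<exists>C>0. \<exists>lam::nat. \<forall>n\<in>smooth_numbers L. N dvd n \<longrightarrow>
    v (x ^ n - 1) = max 1 (v x) ^ n * C * v (of_nat n) ^ lam"
proof -
  consider (big) "1 < v x" | (small) "v x < 1"
    | (far) "v x = 1" "\<And>n. n \<in> smooth_numbers L \<Longrightarrow> 1 \<le> v (x ^ n - 1)"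
    | (near) n where "v x = 1" "n \<in> smooth_numbers L" "v (x ^ n - 1) < 1"
    by force
  then show ?thesis
  proof cases
    case big
    have "v (x ^ n - 1) = max 1 (v x) ^ n * 1 * v (of_nat n) ^ 0" if "n \<in> smooth_numbers L" for n
    proof -
      have "1 < v x ^ n" using big smooth_numbers_pos[OF that] by (rule one_less_power)
      then have "v (- 1 + x ^ n) = v (x ^ n)" by (intro add_eq_right) (simp add: power)
      then show ?thesis using big by (simp add: power)
    qed
    then show ?thesis by (intro bexI[of _ 1] exI[of _ "1::real"] conjI exI[of _ "0::nat"]) auto
  next
    case small
    have "v (x ^ n - 1) = max 1 (v x) ^ n * 1 * v (of_nat n) ^ 0" if "n \<in> smooth_numbers L" for n
    proof -
      have "v x ^ n < 1" using small smooth_numbers_pos[OF that] by (simp add: power_less_one_iff)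
      then have "v (x ^ n + - 1) = v (- 1)" by (intro add_eq_right) (simp add: power)
      then show ?thesis using small by simp
    qed
    then show ?thesis by (intro bexI[of _ 1] exI[of _ "1::real"] conjI exI[of _ "0::nat"]) auto
  next
    case far
    have "v (x ^ n - 1) = max 1 (v x) ^ n * 1 * v (of_nat n) ^ 0" if "n \<in> smooth_numbers L" for n
      using far(2)[OF that] diff_le[of "x ^ n" 1] far(1) by (simp add: power)
    then show ?thesis by (intro bexI[of _ 1] exI[of _ "1::real"] conjI exI[of _ "0::nat"]) auto
  next
    case (near m)
    \<comment> \<open>Only for \<open>q \<in> L\<close> can \<open>q\<close> divide the cofactor
      \<open>n / N\<close>, and then \<open>x ^ N\<close> must be closer to 1 than
      \<open>v (of_nat q)\<close>. For other primes \<open>p\<close>, where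
      \<open>v (of_nat p) = 1\<close>, a distance below 1 suffices.\<close>
    have "\<exists>N\<in>smooth_numbers L. v (x ^ N - 1) < 1 \<and> (q \<in> L \<longrightarrow> v (x ^ N - 1) < v (of_nat q))"
    proof (cases "q \<in> L")
      case True
      have "0 < v (of_nat q)" using q(1) by (simp add: prime_gt_0_nat)
      with power_prime_power_minus_1_small[OF near(3) q(2)] obtain s
        where "v ((x ^ m) ^ q ^ s - 1) < v (of_nat q)" by blast
      then show ?thesis
        using q near(2) True by (intro bexI[of _ "m * q ^ s"])
          (auto simp: power_mult intro: smooth_numbers_mult smooth_numbers_prime_power)
    qed (use near in auto)
    then obtain N where N: "N \<in> smooth_numbers L" "v (x ^ N - 1) < 1"
      "q \<in> L \<Longrightarrow> v (x ^ N - 1) < v (of_nat q)" by blast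
    note N0 = smooth_numbers_pos[OF N(1)]
    \<comment> \<open>Dividing by \<open>v (of_nat N)\<close> in the constant turns the factor
      \<open>v (of_nat k)\<close> from lifting the exponent into
      \<open>v (of_nat n)\<close>.\<close>
    have "v (x ^ n - 1) = max 1 (v x) ^ n * (v (x ^ N - 1) / v (of_nat N)) * v (of_nat n) ^ 1"
      if n: "n \<in> smooth_numbers L" "N dvd n" for n
    proof -
      obtain k where k: "n = N * k" using n(2) by blast
      have "v (x ^ N - 1) < v (of_nat p)" if p: "prime p" "p dvd k" for p
      proof (cases "p = q")
        case True
        then have "q \<in> L" using p smooth_numbers_prime_dvd[OF n(1), of p] by (simp add: k)
        then show ?thesis using N(3) True by simp
      qed (use N(2) unit p in auto)
      then have "v ((x ^ N) ^ k - 1) = v (x ^ N - 1) * v (of_nat k)"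
        using N(2) smooth_numbers_pos[OF n(1)] by (intro lifting_the_exponent) (auto simp: k)
      then show ?thesis
        using near(1) N0 by (simp add: k power_mult mult)
    qed
    moreover have "0 < v (x ^ N - 1) / v (of_nat N)" using x[OF N0] N0 by simp
    ultimately show ?thesis using N(1) by blast
  qed
qed

lemma prod_power_minus_1_eventually:
  assumes q: "prime q" "v (of_nat q) < 1"
    and unit: "\<And>p. prime p \<Longrightarrow> p \<noteq> q \<Longrightarrow> v (of_nat p) = 1"
    and R: "\<And>x n. x \<in># R \<Longrightarrow> 0 < n \<Longrightarrow> x ^ n \<noteq> 1"
  shows "\<exists>N\<in>smooth_numbers L. \<exists>C>0. \<exists>lam::nat. \<forall>n\<in>smooth_numbers L. N dvd n \<longrightarrow>
    (\<Prod>x\<in>#R. v (x ^ n - 1)) = (\<Prod>x\<in>#R. max 1 (v x)) ^ n * C * v (of_nat n) ^ lam"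
  using R
proof (induction R)
  case empty
  show ?case by (intro bexI[of _ 1] exI[of _ "1::real"] conjI exI[of _ "0::nat"]) auto
next
  case (add x R)
  have "x ^ n \<noteq> 1" if "0 < n" for n using add.prems[OF _ that, of x] by simp
  from power_minus_1_eventually[OF q unit this, of L] obtain M C1 lam1 where 1:
    "M \<in> smooth_numbers L" "0 < C1"
    "\<forall>n\<in>smooth_numbers L. M dvd n \<longrightarrow> v (x ^ n - 1) = max 1 (v x) ^ n * C1 * v (of_nat n) ^ lam1"
    by blast
  have "x' ^ n \<noteq> 1" if "x' \<in># R" "0 < n" for x' n
    using add.prems[OF _ that(2), of x'] that(1) by simp
  from add.IH[OF this] obtain N C2 lam2 where 2:
    "N \<in> smooth_numbers L" "0 < C2"
    "\<forall>n\<in>smooth_numbers L. N dvd n \<longrightarrow>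
      (\<Prod>x\<in>#R. v (x ^ n - 1)) = (\<Prod>x\<in>#R. max 1 (v x)) ^ n * C2 * v (of_nat n) ^ lam2"
    by blast
  show ?case
  proof (intro bexI exI conjI ballI impI)
    \<comment> \<open>The product of the two thresholds serves both formulas; constants multiply and
      exponents add.\<close>
    show "M * N \<in> smooth_numbers L" using 1 2 by (intro smooth_numbers_mult)
    show "0 < C1 * C2" using 1 2 by simp
    fix n assume n: "n \<in> smooth_numbers L" "M * N dvd n"
    then have "M dvd n" "N dvd n" by (auto dest: dvd_mult_left dvd_mult_right)
    with 1(3) 2(3) n(1) show "(\<Prod>x\<in>#add_mset x R. v (x ^ n - 1)) =
        (\<Prod>x\<in>#add_mset x R. max 1 (v x)) ^ n * (C1 * C2) * v (of_nat n) ^ (lam1 + lam2)"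
      by (simp add: power_add power_mult_distrib)
  qed
qed

end

section \<open>From absolute values to valuations\<close>

lemma multiplicity_int_of_nat: "multiplicity (int p) (int n) = multiplicity p n"
  by (simp add: multiplicity_def flip: of_nat_power)

text \<open>Common core of both claims, with no condition relating \<open>q\<close> to
  \<open>L\<close>: taking logarithms to base \<open>q\<close> turns the product formula for
  absolute values into a linear one.\<close>

lemma pierce_lehmer_multiplicity_eventually:
  fixes v :: "'c::field_char_0 \<Rightarrow> real"
  assumes f: "no_root_of_unity_root f" and q: "prime q" and v: "adic_complex_abs q v"
  shows "\<exists>(lam::nat) (nu::int). for_big_enough (smooth_numbers L) (\<lambda>n.
    real (multiplicity (int q) (pierce_lehmer f n)) =
      mu_invariant q v f * real n + real lam * real (multiplicity q n) + real_of_int nu)"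
proof -
  interpret nonarchimedean_field v
    using v by unfold_locales (simp add: adic_complex_abs_def)
  have v_of_int: "v (of_int z) = real q powr (- real (multiplicity (int q) z))" if "z \<noteq> 0" for z
    using v that by (simp add: adic_complex_abs_def extends_adic_abs_def)
  have v_of_nat: "v (of_nat n) = real q powr (- real (multiplicity q n))" if "0 < n" for n
    using v_of_int[of "int n"] that by (simp add: multiplicity_int_of_nat)
  have q1: "1 < real q" using prime_gt_1_nat[OF q] by simp
  have vq: "v (of_nat q) < 1"
    using v_of_nat[of q] q1 q prime_gt_0_nat[OF q]
    by (simp add: powr_minus inverse_less_1_iff)
  have unit: "v (of_nat p) = 1" if "prime p" "p \<noteq> q" for p
    using v_of_nat[of p] that q q1 by (simp add: prime_gt_0_nat prime_multiplicity_other)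
  let ?a = "of_int (lead_coeff f) :: 'c"
  define R where "R = proots (map_poly of_int f :: 'c poly)"
  note f0 = no_root_of_unity_root_neq_0[OF f]
  then have split: "map_poly of_int f = Polynomial.smult ?a (\<Prod>x\<in>#R. [:- x, 1:])"
    unfolding R_def by (rule adic_complex_abs_split[OF v])
  note pierce_lehmer = of_int_pierce_lehmer[OF f0 _ split]
  define M where "M = adic_mahler_measure v f"
  have M: "M = v ?a * (\<Prod>x\<in>#R. max 1 (v x))"
    by (simp add: M_def adic_mahler_measure_def R_def)
  have "0 < (\<Prod>x\<in>#R. max 1 (v x))"
    by (induction R) auto
  then have M0: "0 < M" using f0 by (simp add: M)
  from gauss_lemma[of ?a R] obtain i where "v (coeff (map_poly of_int f) i) = M"
    unfolding split[symmetric] M by blast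
  then have i: "v (of_int (coeff f i)) = M" by (simp add: coeff_map_poly)
  then have "coeff f i \<noteq> 0" using M0 by auto
  then have M_powr: "M = real q powr (- real (multiplicity (int q) (coeff f i)))"
    using i v_of_int by simp
  define k where "k = multiplicity (int q) (coeff f i)"
  \<comment> \<open>The Mahler measure is the absolute value of the integer
    \<open>coeff f i\<close>, that is \<open>q\<close> to the power \<open>- k\<close>, so the
    logarithms cancel.\<close>
  have mu: "mu_invariant q v f = real k"
    using q1 by (simp add: mu_invariant_def log_adic_mahler_measure_def M_def[symmetric] M_powr k_def)
  \<comment> \<open>The hypothesis on \<open>f\<close> concerns complex roots; it reaches the roots
    in \<open>'c\<close> through the nonvanishing of the integer
    \<open>pierce_lehmer f n\<close>.\<close>
  have "x ^ n \<noteq> 1" if "x \<in># R" "0 < n" for x n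
  proof
    assume "x ^ n = 1"
    with that(1) have "(\<Prod>x\<in>#R. x ^ n - 1) = 0" by (auto simp: prod_mset_zero_iff)
    with pierce_lehmer[OF that(2)] pierce_lehmer_neq_0[OF f that(2)] show False by simp
  qed
  from prod_power_minus_1_eventually[OF q vq unit this, where L = L] obtain N C lam where N:
    "N \<in> smooth_numbers L" "0 < C"
    "\<forall>n\<in>smooth_numbers L. N dvd n \<longrightarrow>
      (\<Prod>x\<in>#R. v (x ^ n - 1)) = (\<Prod>x\<in>#R. max 1 (v x)) ^ n * C * v (of_nat n) ^ lam"
    by blast
  have log_v: "real (multiplicity (int q) (pierce_lehmer f n)) =
      real k * real n + real lam * real (multiplicity q n) - log (real q) C"
    if n: "n \<in> smooth_numbers L" "N dvd n" for n
  proof -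
    have n0: "0 < n" using n(1) by (rule smooth_numbers_pos)
    have "v (of_int (pierce_lehmer f n)) = M ^ n * C * v (of_nat n) ^ lam"
      using N(3) n by (simp add: pierce_lehmer[OF n0] mult power prod_mset M power_mult_distrib)
    then have "log (real q) (v (of_int (pierce_lehmer f n))) =
        real n * log (real q) M + log (real q) C + real lam * log (real q) (v (of_nat n))"
      using M0 N(2) n0 by (simp add: log_mult log_nat_power)
    then show ?thesis
      using q1 n0 pierce_lehmer_neq_0[OF f n0] by (simp add: v_of_int v_of_nat M_powr k_def algebra_simps)
  qed
  \<comment> \<open>Evaluating the formula at \<open>n = N\<close>, where every other term is an
    integer, shows that the real number \<open>- log (real q) C\<close> is an integer.\<close>
  define nu where "nu = int (multiplicity (int q) (pierce_lehmer f N)) - int k * int N -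
    int lam * int (multiplicity q N)"
  have "- log (real q) C = real_of_int nu"
    using log_v[OF N(1)] by (simp add: nu_def)
  then have "for_big_enough (smooth_numbers L) (\<lambda>n.
    real (multiplicity (int q) (pierce_lehmer f n)) =
      mu_invariant q v f * real n + real lam * real (multiplicity q n) + real_of_int nu)"
    unfolding for_big_enough_def using N(1) log_v mu by (intro bexI[of _ N]) auto
  then show ?thesis by blast
qed

theorem corollary2p10:
  fixes f :: "int poly" and r :: nat and l :: "nat \<Rightarrow> nat" and S :: "nat set"
  assumes "no_root_of_unity_root f"
    and "\<And>i. i \<in> {1..r} \<Longrightarrow> prime (l i)"
    and "inj_on l {1..r}"
    and "S = smooth_numbers (l ` {1..r})"
  shows "(\<forall>j\<in>{1..r}. \<forall>v :: 'c::field_char_0 \<Rightarrow> real. adic_complex_abs (l j) v \<longrightarrow>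
            (\<exists>(lam::nat) (nu::int). for_big_enough S (\<lambda>n.
               \<forall>k :: nat \<Rightarrow> nat. n = (\<Prod>i=1..r. l i ^ k i) \<longrightarrow>
                 real (multiplicity (int (l j)) (pierce_lehmer f n)) =
                   mu_invariant (l j) v f * real n + real lam * real (k j) + real_of_int nu)))
       \<and> (\<forall>p. prime p \<and> p \<notin> l ` {1..r} \<longrightarrow>
            (\<forall>v :: 'c \<Rightarrow> real. adic_complex_abs p v \<longrightarrow>
              (\<exists>nu::int. for_big_enough S (\<lambda>n.
                 real (multiplicity (int p) (pierce_lehmer f n)) =
                   mu_invariant p v f * real n + real_of_int nu))))"
proof (intro conjI ballI allI impI)
  fix j :: nat and v :: "'c \<Rightarrow> real"
  assume j: "j \<in> {1..r}" and v: "adic_complex_abs (l j) v"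
  \<comment> \<open>Injectivity of \<open>l\<close> allows the product to be indexed by distinct
    primes, so \<open>k j\<close> is determined by \<open>n\<close>.\<close>
  have mult: "multiplicity (l j) (\<Prod>i=1..r. l i ^ k i) = k j" for k
  proof -
    have "(\<Prod>i=1..r. l i ^ k i) = (\<Prod>p\<in>l ` {1..r}. p ^ k (inv_into {1..r} l p))"
      using assms(3) by (simp add: prod.reindex)
    also have "multiplicity (l j) \<dots> = k (inv_into {1..r} l (l j))"
      using assms(2) j by (subst multiplicity_prod_prime_powers) auto
    finally show ?thesis using assms(3) j by (simp del: atLeastAtMost_iff)
  qed
  from pierce_lehmer_multiplicity_eventually[OF assms(1) assms(2)[OF j] v, of "l ` {1..r}"]
  obtain lam nu where "for_big_enough S (\<lambda>n.
      real (multiplicity (int (l j)) (pierce_lehmer f n)) =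
        mu_invariant (l j) v f * real n + real lam * real (multiplicity (l j) n) + real_of_int nu)"
    unfolding assms(4) by (elim exE)
  then show "\<exists>(lam::nat) (nu::int). for_big_enough S (\<lambda>n.
               \<forall>k :: nat \<Rightarrow> nat. n = (\<Prod>i=1..r. l i ^ k i) \<longrightarrow>
                 real (multiplicity (int (l j)) (pierce_lehmer f n)) =
                   mu_invariant (l j) v f * real n + real lam * real (k j) + real_of_int nu)"
    by (intro exI[of _ lam] exI[of _ nu], elim for_big_enough_mono, intro allI impI)
      (simp only: mult)
next
  fix p :: nat and v :: "'c \<Rightarrow> real"
  assume p: "prime p \<and> p \<notin> l ` {1..r}" and v: "adic_complex_abs p v"
  \<comment> \<open>A prime outside the list divides no element of \<open>S\<close>, so the term
    with \<open>lam\<close> vanishes whatever \<open>lam\<close> is.\<close>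
  have mult: "multiplicity p n = 0" if "n \<in> S" for n
    using that p smooth_numbers_prime_dvd[of n "l ` {1..r}" p]
    by (intro not_dvd_imp_multiplicity_0) (auto simp: assms(4))
  from pierce_lehmer_multiplicity_eventually[OF assms(1) conjunct1[OF p] v, of "l ` {1..r}"]
  obtain lam nu where "for_big_enough S (\<lambda>n. real (multiplicity (int p) (pierce_lehmer f n)) =
      mu_invariant p v f * real n + real (lam::nat) * real (multiplicity p n) + real_of_int nu)"
    unfolding assms(4) by (elim exE)
  then show "\<exists>nu::int. for_big_enough S (\<lambda>n.
                 real (multiplicity (int p) (pierce_lehmer f n)) =
                   mu_invariant p v f * real n + real_of_int nu)"
    by (intro exI[of _ nu], elim for_big_enough_mono) (simp add: mult)
qed

end
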